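(* Let $C$ be a ternary linear $[n,k,d]$ code that is a three-weight code, i.e. its codewords have exactly three distinct nonzero Hamming weights. Let $C^{\perp}$ be its dual code, with minimum weight $d^{\perp}$. Suppose $C$ satisfies the AM-condition, i.e. there exists $t\in\mathbb{N}$ with $$d^{\perp}-t=\#\{u \mid C_u\neq\emptyset,\ 0<u\leq n-t\},$$ where $C_u=\{c\in C\mid \mathrm{wt}(c)=u\}$. Then $d^{\perp}\leq 6$ and $t\leq 5$.
   Context: A ternary $[n,k,d]$ code is a $k$-dimensional subspace of $\mathbb{F}_3^n$ with minimum nonzero Hamming weight $d$. $C^{\perp}$ is the dual of $C$ with respect to the standard inner product on $\mathbb{F}_3^n$. *)

theory Defs
  imports "HOL-Analysis.Cartesian_Space"
begin

definition hamming_weight :: "('a::zero) ^ 'n::finite \<Rightarrow> nat"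
  where "hamming_weight x = card {i. x $ i \<noteq> 0}"

text \<open>A relation rather than a function: the zero code has no minimum weight.\<close>

definition is_min_weight :: "(('a::zero) ^ 'n::finite) set \<Rightarrow> nat \<Rightarrow> bool"
  where "is_min_weight C d \<longleftrightarrow>
    (\<exists>c\<in>C. c \<noteq> 0 \<and> hamming_weight c = d) \<and>
    (\<forall>c\<in>C. c \<noteq> 0 \<longrightarrow> d \<le> hamming_weight c)"

definition is_linear_code :: "nat \<Rightarrow> nat \<Rightarrow> nat \<Rightarrow> (('a::field) ^ 'n::finite) set \<Rightarrow> bool"
  where "is_linear_code n k d C \<longleftrightarrow>
    n = CARD('n) \<and> vec.subspace C \<and> vec.dim C = k \<and> is_min_weight C d"

definition dual_code :: "(('a::field) ^ 'n::finite) set \<Rightarrow> ('a ^ 'n) set"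
  where "dual_code C = {x. \<forall>c\<in>C. (\<Sum>i\<in>UNIV. x $ i * c $ i) = 0}"

definition weight_class :: "(('a::zero) ^ 'n::finite) set \<Rightarrow> nat \<Rightarrow> ('a ^ 'n) set"
  where "weight_class C u = {c \<in> C. hamming_weight c = u}"

definition three_weight_code :: "(('a::zero) ^ 'n::finite) set \<Rightarrow> bool"
  where "three_weight_code C \<longleftrightarrow> card {u. weight_class C u \<noteq> {} \<and> 0 < u} = 3"

text \<open>Both differences are taken in the integers, so that neither is truncated at zero.
  The parameter \<open>d'\<close> stands for the minimum weight of the dual code.\<close>

definition AM_condition :: "(('a::zero) ^ 'n::finite) set \<Rightarrow> nat \<Rightarrow> nat \<Rightarrow> bool"
  where "AM_condition C d' t \<longleftrightarrow>
    int d' - int t =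
      int (card {u. weight_class C u \<noteq> {} \<and> 0 < u \<and> int u \<le> int CARD('n) - int t})"

end

(* The dual distance d' makes C an orthogonal array of strength d' - 1, so the first d' - 1
   factorial moments of the weight (and of the number of zeros) of a codeword are binomial.

   If d' >= 7, the six moments force the cubic f whose roots are the three weights to be, up to
   scaling, the Lloyd polynomial of a perfect 3-error-correcting ternary code.  Hence the weights
   have sum 2n, known variance of order n, and product 2 |C| / 9, which is twice a power of 3.
   So two of the weights are distinct powers of 3; their ratio is at least 3, which makes the
   variance of order n^2, a contradiction for n >= 7.

   If t > 5, then t = d' = 6 and every nonzero codeword has fewer than six zeros.  Then |C| = 3^5,
   the moments determine the weight distribution, and it is nonnegative only for n = 6 or n = 7,
   where more than three weights occur. *)
theory Submission
  imports Defs "HOL-Computational_Algebra.Primes"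
begin

section \<open>Finiteness of the ambient space and elementary facts on Hamming weight\<close>

lemma finite_vec_UNIV:
  assumes "finite (UNIV :: 'a set)"
  shows "finite (UNIV :: ('a ^ 'n::finite) set)"
proof -
  have "finite {f :: 'n \<Rightarrow> 'a. \<forall>x. (x \<in> UNIV \<longrightarrow> f x \<in> UNIV) \<and> (x \<notin> UNIV \<longrightarrow> f x = undefined)}"
    by (rule finite_set_of_finite_funs) (use assms in auto)
  then have "finite (UNIV :: ('n \<Rightarrow> 'a) set)" by simp
  then have "finite (vec_lambda ` (UNIV :: ('n \<Rightarrow> 'a) set))" by simp
  moreover have "range vec_lambda = (UNIV :: ('a ^ 'n) set)"
    by (metis surj_def vec_nth_inverse)
  ultimately show ?thesis by simp
qed

lemma hamming_weight_le: "hamming_weight (x :: ('a::zero) ^ 'n::finite) \<le> CARD('n)"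
  unfolding hamming_weight_def by (rule card_mono) auto

lemma hamming_weight_eq_0_iff:
  "hamming_weight (x :: ('a::zero) ^ 'n::finite) = 0 \<longleftrightarrow> x = 0"
  by (simp add: hamming_weight_def vec_eq_iff)

lemma card_zeros_eq:
  "card {i. x $ i = 0} = CARD('n) - hamming_weight (x :: ('a::zero) ^ 'n::finite)"
proof -
  have "{i. x $ i = 0} = UNIV - {i. x $ i \<noteq> 0}" by auto
  then show ?thesis unfolding hamming_weight_def by (simp add: card_Diff_subset)
qed

section \<open>Codes as orthogonal arrays\<close>

text \<open>Otherwise the restriction of \<open>C\<close> to \<open>S\<close> misses the unit vector
  at \<open>i\<close>, and some linear functional vanishes on that restriction but not at the unit
  vector. Its coefficients form a nonzero dual codeword supported in \<open>S\<close>, which is too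
  light.\<close>

lemma dual_distance_separates:
  fixes C :: "(('a::field) ^ 'n::finite) set"
  assumes C: "vec.subspace C" and d': "is_min_weight (dual_code C) d'"
    and S: "card S < d'" "i \<in> S"
  shows "\<exists>e\<in>C. e $ i = 1 \<and> (\<forall>j\<in>S - {i}. e $ j = 0)"
proof -
  define P :: "'a ^ 'n \<Rightarrow> 'a ^ 'n" where "P c = (\<chi> j. if j \<in> S then c $ j else 0)" for c
  have linP: "Vector_Spaces.linear (*s) (*s) P"
    by unfold_locales (auto simp: P_def vec_eq_iff)
  interpret P: Vector_Spaces.linear "(*s)" "(*s)" P by (rule linP)
  interpret F: vector_space_pair "(*s) :: 'a \<Rightarrow> 'a ^ 'n \<Rightarrow> 'a ^ 'n" "(*) :: 'a \<Rightarrow> 'a \<Rightarrow> 'a"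
    by unfold_locales (auto simp: algebra_simps)
  have sub: "vec.subspace (P ` C)" by (rule P.subspace_image[OF C])
  have "axis i 1 \<in> P ` C"
  proof (rule ccontr)
    assume not_mem: "axis i 1 \<notin> P ` C"
    obtain B where B: "B \<subseteq> P ` C" "vec.independent B" "P ` C \<subseteq> vec.span B"
      by (rule vec.basis_exists[of "P ` C"])
    have spanB: "vec.span B = P ` C" by (rule vec.span_subspace[OF B(1,3) sub])
    have ind: "vec.independent (insert (axis i 1) B)"
      using B(2) not_mem spanB by (simp add: vec.independent_insert)
    obtain \<phi> where \<phi>: "Vector_Spaces.linear (*s) (*) \<phi>"
      and \<phi>_eq: "\<And>b. b \<in> insert (axis i 1) B \<Longrightarrow> \<phi> b = (if b = axis i 1 then 1 else 0)"
      using F.linear_independent_extend[OF ind, of "\<lambda>b. if b = axis i 1 then 1 else 0"] by blast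
    interpret \<phi>: Vector_Spaces.linear "(*s)" "(*)" \<phi> by (rule \<phi>)
    have \<phi>0: "\<phi> v = 0" if "v \<in> P ` C" for v
    proof (rule \<phi>.eq_0_on_span[of B])
      show "\<phi> b = 0" if "b \<in> B" for b
        using that \<phi>_eq[of b] not_mem B(1) by auto
      show "v \<in> vec.span B" using that spanB by simp
    qed
    \<comment> \<open>The coordinate vector of \<open>\<phi>\<close>, cut off outside
      \<open>S\<close>: its inner product with \<open>c\<close> is
      \<open>\<phi> (P c)\<close>.\<close>
    define x :: "'a ^ 'n" where "x = (\<chi> j. if j \<in> S then \<phi> (axis j 1) else 0)"
    have "(\<Sum>j\<in>UNIV. x $ j * c $ j) = 0" if "c \<in> C" for c
    proof -
      have "\<phi> (P c) = \<phi> (\<Sum>j\<in>UNIV. (P c $ j) *s axis j 1)" by (simp only: basis_expansion)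
      also have "\<dots> = (\<Sum>j\<in>UNIV. P c $ j * \<phi> (axis j 1))"
        by (simp only: \<phi>.sum \<phi>.scale)
      also have "\<dots> = (\<Sum>j\<in>UNIV. x $ j * c $ j)"
        by (rule sum.cong) (auto simp: P_def x_def)
      finally show ?thesis using \<phi>0 that by auto
    qed
    then have "x \<in> dual_code C" by (simp add: dual_code_def)
    moreover have "x $ i \<noteq> 0" using \<phi>_eq[of "axis i 1"] S(2) by (simp add: x_def)
    then have "x \<noteq> 0" by auto
    ultimately have "d' \<le> hamming_weight x" using d' by (simp add: is_min_weight_def)
    also have "\<dots> \<le> card S"
      unfolding hamming_weight_def by (rule card_mono) (auto simp: x_def)
    finally show False using S(1) by simp
  qed
  then obtain e where e: "e \<in> C" "axis i 1 = P e" by auto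
  have "e $ j = (if j = i then 1 else 0)" if "j \<in> S" for j
    using arg_cong[OF e(2), of "\<lambda>v. v $ j"] that by (simp add: P_def axis_def)
  then show ?thesis using e(1) S(2) by (intro bexI[of _ e]) auto
qed

text \<open>Translating by multiples of \<open>e\<close> permutes \<open>A\<close> and shifts the
  \<open>i\<close>-th coordinate, so all values of that coordinate are taken equally often.\<close>

lemma card_translation_invariant:
  fixes A :: "(('a::field) ^ 'n::finite) set"
  assumes fin: "finite (UNIV :: 'a set)" and e: "e $ i = 1"
    and inv: "\<And>c a. c \<in> A \<Longrightarrow> c + a *s e \<in> A"
  shows "CARD('a) * card {c \<in> A. c $ i \<in> T} = card T * card A"
proof -
  have finA: "finite A" by (rule finite_subset[OF subset_UNIV finite_vec_UNIV[OF fin]])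
  define K where "K = card {c \<in> A. c $ i = 0}"
  have K: "card {c \<in> A. c $ i = a} = K" for a
    unfolding K_def
  proof (rule bij_betw_same_card[of "\<lambda>c. c + (-a) *s e"],
      rule bij_betw_byWitness[where f' = "\<lambda>c. c + a *s e"])
    show "\<forall>c\<in>{c \<in> A. c $ i = a}. c + (-a) *s e + a *s e = c" by simp
    show "\<forall>c\<in>{c \<in> A. c $ i = 0}. c + a *s e + (-a) *s e = c" by simp
    show "(\<lambda>c. c + (-a) *s e) ` {c \<in> A. c $ i = a} \<subseteq> {c \<in> A. c $ i = 0}"
      using e inv[of _ "-a"] by auto
    show "(\<lambda>c. c + a *s e) ` {c \<in> A. c $ i = 0} \<subseteq> {c \<in> A. c $ i = a}"
      using e inv[of _ a] by auto
  qed
  have *: "card {c \<in> A. c $ i \<in> T} = card T * K" for T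
  proof -
    have "{c \<in> A. c $ i \<in> T} = (\<Union>a\<in>T. {c \<in> A. c $ i = a})" by auto
    also have "card \<dots> = (\<Sum>a\<in>T. card {c \<in> A. c $ i = a})"
      by (rule card_UN_disjoint) (use finA finite_subset[OF subset_UNIV fin] in auto)
    finally show ?thesis by (simp add: K)
  qed
  from *[of UNIV] *[of T] show ?thesis by (simp add: mult_ac)
qed

text \<open>Zero conditions are imposed one coordinate at a time. Each divides the cardinality by
  \<open>CARD('a)\<close> if some remaining word is nonzero there and changes nothing otherwise; in
  the end only the zero word is left.\<close>

lemma card_subspace_power:
  fixes C :: "(('a::field) ^ 'n::finite) set"
  assumes fin: "finite (UNIV :: 'a set)" and C: "vec.subspace C"
  shows "\<exists>k. card C = CARD('a) ^ k"
proof -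
  have "\<exists>k. card C = CARD('a) ^ k * card {c \<in> C. \<forall>i\<in>S. c $ i = 0}" for S :: "'n set"
  proof (induction S rule: finite_induct[OF finite])
    case 1
    show ?case by (rule exI[of _ 0]) simp
  next
    case (2 i S)
    then obtain k where k: "card C = CARD('a) ^ k * card {c \<in> C. \<forall>i\<in>S. c $ i = 0}" by blast
    let ?A = "{c \<in> C. \<forall>i\<in>S. c $ i = 0}"
    have ins: "{c \<in> C. \<forall>j\<in>insert i S. c $ j = 0} = {c \<in> ?A. c $ i \<in> {0}}" by auto
    show ?case
    proof (cases "\<exists>c\<in>?A. c $ i \<noteq> 0")
      case True
      then obtain c where c: "c \<in> ?A" "c $ i \<noteq> 0" by blast
      define e where "e = inverse (c $ i) *s c"
      have e: "e $ i = 1" using c(2) by (simp add: e_def)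
      have "CARD('a) * card {c \<in> ?A. c $ i \<in> {0}} = card {0 :: 'a} * card ?A"
      proof (rule card_translation_invariant[OF fin e])
        show "x + a *s e \<in> ?A" if "x \<in> ?A" for x a
          using that c(1) C by (auto simp: e_def intro!: vec.subspace_add vec.subspace_scale)
      qed
      then have "card C = CARD('a) ^ Suc k * card {c \<in> ?A. c $ i \<in> {0}}"
        using k by simp
      then show ?thesis unfolding ins by blast
    next
      case False
      then have "{c \<in> ?A. c $ i \<in> {0}} = ?A" by auto
      then show ?thesis unfolding ins using k by auto
    qed
  qed
  from this[of UNIV] obtain k
    where k: "card C = CARD('a) ^ k * card {c \<in> C. \<forall>i\<in>UNIV. c $ i = 0}" by blast
  have "{c \<in> C. \<forall>i\<in>UNIV. c $ i = 0} = {0}"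
    using vec.subspace_0[OF C] by (auto simp: vec_eq_iff)
  then show ?thesis using k by auto
qed

text \<open>Induction on \<open>S\<close>: the separating codeword \<open>e\<close> moves the new
  coordinate \<open>i\<close> and fixes those already treated, so the condition at \<open>i\<close>
  keeps the fraction \<open>card T / CARD('a)\<close> of the words.\<close>

lemma card_orthogonal_array:
  fixes C :: "(('a::field) ^ 'n::finite) set"
  assumes fin: "finite (UNIV :: 'a set)" and C: "vec.subspace C"
    and d': "is_min_weight (dual_code C) d'" and S: "card S < d'"
  shows "CARD('a) ^ card S * card {c \<in> C. \<forall>i\<in>S. c $ i \<in> T} = card T ^ card S * card C"
  using finite[of S] S
proof (induction S rule: finite_induct)
  case empty
  then show ?case by simp
next
  case (insert i S)
  let ?A = "{c \<in> C. \<forall>i\<in>S. c $ i \<in> T}"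
  have ins: "{c \<in> C. \<forall>j\<in>insert i S. c $ j \<in> T} = {c \<in> ?A. c $ i \<in> T}" by auto
  obtain e where e: "e \<in> C" "e $ i = 1" and e0: "\<forall>j\<in>insert i S - {i}. e $ j = 0"
    using dual_distance_separates[OF C d' insert.prems, of i] by auto
  have step: "CARD('a) * card {c \<in> ?A. c $ i \<in> T} = card T * card ?A"
  proof (rule card_translation_invariant[OF fin e(2)])
    show "c + a *s e \<in> ?A" if "c \<in> ?A" for c a
    proof -
      have "(c + a *s e) $ j \<in> T" if "j \<in> S" for j
        using that \<open>c \<in> ?A\<close> e0 insert.hyps(2) by auto
      moreover have "c + a *s e \<in> C"
        using that C e(1) by (auto intro!: vec.subspace_add vec.subspace_scale)
      ultimately show ?thesis by blast
    qed
  qed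
  have IH: "CARD('a) ^ card S * card ?A = card T ^ card S * card C"
    using insert by simp
  have "CARD('a) ^ card (insert i S) * card {c \<in> ?A. c $ i \<in> T}
      = CARD('a) ^ card S * (CARD('a) * card {c \<in> ?A. c $ i \<in> T})"
    using insert.hyps by simp
  also have "\<dots> = card T * (CARD('a) ^ card S * card ?A)" unfolding step by simp
  also have "\<dots> = card T ^ card (insert i S) * card C"
    unfolding IH using insert.hyps by simp
  finally show ?case unfolding ins .
qed

section \<open>Moments of the weight distribution\<close>

text \<open>Double count of the pairs of a codeword and a \<open>j\<close>-set of coordinates on
  which all its entries lie in \<open>T\<close>. Taking for \<open>T\<close> the nonzero elements
  gives moments of the weight, taking \<open>{0}\<close> those of the number of zeros.\<close>

lemma sum_binomial_moments:
  fixes C :: "(('a::field) ^ 'n::finite) set"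
  assumes fin: "finite (UNIV :: 'a set)" and C: "vec.subspace C"
    and d': "is_min_weight (dual_code C) d'" and j: "j < d'"
  shows "CARD('a) ^ j * (\<Sum>c\<in>C. card {i. c $ i \<in> T} choose j)
    = (CARD('n) choose j) * card T ^ j * card C"
proof -
  have finC: "finite C" by (rule finite_subset[OF subset_UNIV finite_vec_UNIV[OF fin]])
  let ?\<S> = "{S :: 'n set. card S = j}"
  have "(\<Sum>c\<in>C. card {i. c $ i \<in> T} choose j)
      = (\<Sum>c\<in>C. \<Sum>S\<in>?\<S>. if \<forall>i\<in>S. c $ i \<in> T then 1 else 0)"
  proof (rule sum.cong[OF refl])
    fix c assume "c \<in> C"
    have "card {i. c $ i \<in> T} choose j = card {S. S \<subseteq> {i. c $ i \<in> T} \<and> card S = j}"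
      by (rule n_subsets[symmetric]) simp
    also have "{S. S \<subseteq> {i. c $ i \<in> T} \<and> card S = j} = {S \<in> ?\<S>. \<forall>i\<in>S. c $ i \<in> T}" by auto
    also have "card \<dots> = (\<Sum>S\<in>?\<S>. if \<forall>i\<in>S. c $ i \<in> T then 1 else 0)"
      by (simp add: sum.If_cases Int_def)
    finally show "card {i. c $ i \<in> T} choose j = (\<Sum>S\<in>?\<S>. if \<forall>i\<in>S. c $ i \<in> T then 1 else 0)" .
  qed
  also have "\<dots> = (\<Sum>S\<in>?\<S>. card {c \<in> C. \<forall>i\<in>S. c $ i \<in> T})"
    by (subst sum.swap) (simp add: sum.If_cases[OF finC] Int_def)
  finally have "CARD('a) ^ j * (\<Sum>c\<in>C. card {i. c $ i \<in> T} choose j)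
      = (\<Sum>S\<in>?\<S>. CARD('a) ^ card S * card {c \<in> C. \<forall>i\<in>S. c $ i \<in> T})"
    by (simp add: sum_distrib_left)
  also have "\<dots> = (\<Sum>S\<in>?\<S>. card T ^ j * card C)"
    by (rule sum.cong) (use card_orthogonal_array[OF fin C d'] j in auto)
  also have "\<dots> = (CARD('n) choose j) * card T ^ j * card C"
    using n_subsets[of "UNIV :: 'n set" j] by simp
  finally show ?thesis .
qed

text \<open>These are the factorial moments of a binomial distribution with success probability 2/3,
  since two of the three field elements are nonzero.\<close>

lemma sum_falling_moments:
  fixes C :: "(('a::field) ^ 'n::finite) set"
  assumes q: "CARD('a) = 3" and C: "vec.subspace C"
    and d': "is_min_weight (dual_code C) d'" and j: "j < d'"
  shows "(\<Sum>c\<in>C. \<Prod>i=0..<j. real (hamming_weight c) - real i)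
    = real (card C) * (2 / 3) ^ j * (\<Prod>i=0..<j. real CARD('n) - real i)"
proof -
  have fin: "finite (UNIV :: 'a set)" using q card_ge_0_finite by force
  have T: "card (- {0 :: 'a}) = 2" using q fin by (simp add: Compl_eq_Diff_UNIV card_Diff_subset)
  have wt: "hamming_weight c = card {i. c $ i \<in> - {0}}" for c :: "'a ^ 'n"
    by (simp add: hamming_weight_def)
  have falling: "(\<Prod>i=0..<j. real m - real i) = fact j * real (m choose j)" for m
    using gbinomial_mult_fact[of j "real m"] by (simp add: binomial_gbinomial)
  have "3 ^ j * (\<Sum>c\<in>C. hamming_weight c choose j) = (CARD('n) choose j) * 2 ^ j * card C"
    using sum_binomial_moments[OF fin C d' j, of "- {0}"] unfolding q T wt .
  from arg_cong[OF this, of real]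
  have "3 ^ j * (\<Sum>c\<in>C. real (hamming_weight c choose j))
      = real (CARD('n) choose j) * 2 ^ j * real (card C)"
    by simp
  then have "(\<Sum>c\<in>C. real (hamming_weight c choose j)) = real (card C) * (2/3)^j * real (CARD('n) choose j)"
    by (simp add: field_simps)
  then show ?thesis unfolding falling by (simp add: sum_distrib_left[symmetric])
qed

section \<open>Excluding dual distance at least 7 by the Lloyd polynomial\<close>

lemma odd_dvd_two_times_power_three:
  fixes u :: nat
  assumes "u dvd 2 * 3 ^ k" "odd u"
  shows "\<exists>a. u = 3 ^ a"
proof -
  have "coprime u 2" using assms(2) by simp
  then have "u dvd 3 ^ k" using assms(1) coprime_dvd_mult_right_iff by blast
  then show ?thesis using divides_primepow_nat[of 3 u k] by auto
qed

text \<open>With \<open>W\<close> binomially distributed with parameters \<open>n\<close> and \<open>2/3\<close>, and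
  \<open>f = (x-1)(x-2)(x-3) + \<alpha>(x-1)(x-2) + \<beta>(x-1) + \<gamma>\<close>, the three hypotheses say that the expectations of
  \<open>W f(W)\<close>, \<open>W (W-1) f(W)\<close> and \<open>W (W-1) (W-2) f(W)\<close> vanish.\<close>

lemma lloyd_elementary_symmetric:
  fixes n \<alpha> \<beta> \<gamma> :: real
  assumes n: "n \<ge> 7"
    and E1: "(2/3)^4 * (n*(n-1)*(n-2)*(n-3)) + \<alpha> * ((2/3)^3 * (n*(n-1)*(n-2)))
      + \<beta> * ((2/3)^2 * (n*(n-1))) + \<gamma> * ((2/3) * n) = 0"
    and E2: "(2/3)^5 * (n*(n-1)*(n-2)*(n-3)*(n-4)) + (3 + \<alpha>) * ((2/3)^4 * (n*(n-1)*(n-2)*(n-3)))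
      + (2 * \<alpha> + \<beta>) * ((2/3)^3 * (n*(n-1)*(n-2))) + (\<beta> + \<gamma>) * ((2/3)^2 * (n*(n-1))) = 0"
    and E3: "(2/3)^6 * (n*(n-1)*(n-2)*(n-3)*(n-4)*(n-5))
      + (6 + \<alpha>) * ((2/3)^5 * (n*(n-1)*(n-2)*(n-3)*(n-4)))
      + (6 + 4 * \<alpha> + \<beta>) * ((2/3)^4 * (n*(n-1)*(n-2)*(n-3)))
      + (2 * \<alpha> + 2 * \<beta> + \<gamma>) * ((2/3)^3 * (n*(n-1)*(n-2))) = 0"
  shows "\<alpha> = 6 - 2 * n" "\<beta> = 4/3 * (n-2) * (n-3)" "\<gamma> = - (8/27) * (n-1) * (n-2) * (n-3)"
proof -
  have nz: "n \<noteq> 0" "n - 1 \<noteq> 0" "n - 2 \<noteq> 0" using n by auto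
  \<comment> \<open>Each equation is divided by its nonzero common factor \<open>n\<close>,
    \<open>n*(n-1)\<close> or \<open>n*(n-1)*(n-2)\<close>.\<close>
  have "n * ((2/3)^3 * ((n-1)*(n-2)*(n-3)) + \<alpha> * ((2/3)^2 * ((n-1)*(n-2)))
      + \<beta> * ((2/3) * (n-1)) + \<gamma>) = 0"
    using E1 by (simp add: field_simps power_numeral_reduce)
  then have F1: "(2/3)^3 * ((n-1)*(n-2)*(n-3)) + \<alpha> * ((2/3)^2 * ((n-1)*(n-2)))
      + \<beta> * ((2/3) * (n-1)) + \<gamma> = 0" using nz by simp
  have "n * (n-1) * ((2/3)^3 * ((n-2)*(n-3)*(n-4)) + (3 + \<alpha>) * ((2/3)^2 * ((n-2)*(n-3)))
      + (2 * \<alpha> + \<beta>) * ((2/3) * (n-2)) + (\<beta> + \<gamma>)) = 0"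
    using E2 by (simp add: field_simps power_numeral_reduce)
  then have F2: "(2/3)^3 * ((n-2)*(n-3)*(n-4)) + (3 + \<alpha>) * ((2/3)^2 * ((n-2)*(n-3)))
      + (2 * \<alpha> + \<beta>) * ((2/3) * (n-2)) + (\<beta> + \<gamma>) = 0" using nz by simp
  have "n * (n-1) * (n-2) * ((2/3)^3 * ((n-3)*(n-4)*(n-5)) + (6 + \<alpha>) * ((2/3)^2 * ((n-3)*(n-4)))
      + (6 + 4 * \<alpha> + \<beta>) * ((2/3) * (n-3)) + (2 * \<alpha> + 2 * \<beta> + \<gamma>)) = 0"
    using E3 by (simp add: field_simps power_numeral_reduce)
  then have F3: "(2/3)^3 * ((n-3)*(n-4)*(n-5)) + (6 + \<alpha>) * ((2/3)^2 * ((n-3)*(n-4)))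
      + (6 + 4 * \<alpha> + \<beta>) * ((2/3) * (n-3)) + (2 * \<alpha> + 2 * \<beta> + \<gamma>) = 0" using nz by simp
  \<comment> \<open>The coefficient of \<open>\<gamma>\<close> is 1 in \<open>F1\<close>,
    \<open>F2\<close> and \<open>F3\<close>, so differences eliminate it here and in the next
    equation.\<close>
  have G2: "\<beta> = - (4/3) * (n-2) * (n - 3 + \<alpha>)"
    using F1 F2 by (simp add: field_simps power_numeral_reduce)
  have "2 * \<beta> + \<alpha> * (8 * n - 14) / 3 + 4 / 3 * (n-3) * (2 * n - 3) = 0"
    using F1 F3 by (simp add: field_simps power_numeral_reduce)
  then show \<alpha>: "\<alpha> = 6 - 2 * n"
    unfolding G2 by (simp add: field_simps power_numeral_reduce)
  show \<beta>: "\<beta> = 4/3 * (n-2) * (n-3)"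
    unfolding G2 \<alpha> by (simp add: field_simps)
  show "\<gamma> = - (8/27) * (n-1) * (n-2) * (n-3)"
    using F1 unfolding \<alpha> \<beta> by (simp add: field_simps power_numeral_reduce)
qed

text \<open>The two symmetric functions make the deviations of \<open>u\<close>, \<open>v\<close>,
  \<open>w\<close> from their mean \<open>2 * n / 3\<close> of order the square root of
  \<open>n\<close>, whereas \<open>v \<ge> 3 * u\<close> forces one of order
  \<open>n\<close>.\<close>

lemma no_lloyd_roots_of_ratio_three:
  fixes n u v w :: real
  assumes n: "n \<ge> 7" and u: "u \<ge> 0" and v: "v \<ge> 3 * u" and e1: "u + v + w = 2 * n"
    and e2: "u * v + v * w + u * w = (4 * n^2 - 2 * n + 3) / 3"
  shows False
proof -
  define x where "x = u - 2 * n / 3"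
  define y where "y = v - 2 * n / 3"
  have w: "w = 2 * n - u - v" using e1 by simp
  \<comment> \<open>The third deviation is \<open>- x - y\<close>, so the left side is the sum of
    the three squared deviations.\<close>
  have Q: "2 * (x^2 + x*y + y^2) = 4 * n / 3 - 2"
    using e2 unfolding x_def y_def w by (simp add: field_simps power2_eq_square)
  have "(4 * n / 3)^2 \<le> (y - 3 * x)^2"
    by (rule power_mono) (use n v in \<open>auto simp: x_def y_def\<close>)
  \<comment> \<open>Cauchy-Schwarz with explicit remainder: 26/3 is the squared length of (-3, 1, 0)
    projected to the plane of sum zero, in which the deviations lie.\<close>
  also have "\<dots> = 26/3 * (2 * (x^2 + x*y + y^2)) - (5 * x + 7 * y)^2 / 3"
    by (simp add: field_simps power2_eq_square)
  also have "\<dots> \<le> 26/3 * (4 * n / 3 - 2)" unfolding Q using zero_le_power2[of "5 * x + 7 * y"] by linarith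
  finally have "4 * (n * n) \<le> 26 * n - 39" by (simp add: field_simps power2_eq_square)
  moreover have "7 * n \<le> n * n" using n by simp
  ultimately show False using n by linarith
qed

text \<open>Multiplying the cubic \<open>f\<close> by falling factorials of degree 1, 2 and 3 gives
  polynomials of degree at most 6 vanishing at every weight in the code, so six moments yield three
  linear equations for its three coefficients. Summing \<open>f\<close> itself then gives the
  product of the weights.\<close>

lemma three_weights_dual_distance_le_6:
  fixes C :: "(('a::field) ^ 'n::finite) set"
  assumes q: "CARD('a) = 3" and C: "vec.subspace C"
    and d': "is_min_weight (dual_code C) d'"
    and three: "card {u. weight_class C u \<noteq> {} \<and> 0 < u} = 3"
  shows "d' \<le> 6"
proof (rule ccontr)
  assume "\<not> d' \<le> 6"
  then have d'7: "d' \<ge> 7" by simp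
  have fin: "finite (UNIV :: 'a set)" using q card_ge_0_finite by force
  have finC: "finite C" by (rule finite_subset[OF subset_UNIV finite_vec_UNIV[OF fin]])
  define n where "n = real CARD('n)"
  define M where "M = real (card C)"
  have n7: "n \<ge> 7"
  proof -
    obtain x where "hamming_weight (x :: 'a ^ 'n) = d'" using d' by (auto simp: is_min_weight_def)
    then show ?thesis using hamming_weight_le[of x] d'7 by (simp add: n_def)
  qed
  have "0 \<in> C" by (rule vec.subspace_0[OF C])
  then have M0: "M > 0" using finC by (auto simp: M_def card_gt_0_iff)
  obtain u v w where W: "{u. weight_class C u \<noteq> {} \<and> 0 < u} = {u, v, w}"
    and dist: "u \<noteq> v" "v \<noteq> w" "u \<noteq> w"
    using three card_3_iff by metis
  have wt: "hamming_weight c \<in> {u, v, w}" if "c \<in> C" "c \<noteq> 0" for c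
    using that hamming_weight_eq_0_iff[of c] unfolding W[symmetric] by (auto simp: weight_class_def)
  define s1 where "s1 = real u + real v + real w"
  define s2 where "s2 = real u * real v + real v * real w + real u * real w"
  define s3 where "s3 = real u * real v * real w"
  define f where "f x = (x - real u) * (x - real v) * (x - real w)" for x
  have f: "f (real (hamming_weight c)) = 0" if "c \<in> C" "c \<noteq> 0" for c
    using wt[OF that] by (auto simp: f_def)
  \<comment> \<open>The coefficients of \<open>f\<close> in the basis of falling factorials of \<open>x - 1\<close>.\<close>
  define \<alpha> where "\<alpha> = 6 - s1"
  define \<beta> where "\<beta> = s2 + 7 - 3 * s1"
  define \<gamma> where "\<gamma> = 1 - s1 + s2 - s3"
  have f_eq: "f x = (x-1)*(x-2)*(x-3) + \<alpha> * ((x-1)*(x-2)) + \<beta> * (x-1) + \<gamma>" for x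
    by (simp add: f_def \<alpha>_def \<beta>_def \<gamma>_def s1_def s2_def s3_def algebra_simps)
  let ?h = "\<lambda>c. real (hamming_weight c)"
  have mom: "(\<Sum>c\<in>C. \<Prod>i=0..<j. ?h c - real i) = M * ((2/3) ^ j * (\<Prod>i=0..<j. n - real i))"
    if "j < 7" for j
    using sum_falling_moments[OF q C d', of j] that d'7 by (simp add: M_def n_def)
  have m1: "(\<Sum>c\<in>C. ?h c) = M * ((2/3) * n)"
    using mom[of 1] by simp
  have m2: "(\<Sum>c\<in>C. ?h c * (?h c - 1)) = M * ((2/3)^2 * (n * (n-1)))"
    using mom[of 2] by (simp add: prod.atLeast0_lessThan_Suc eval_nat_numeral)
  have m3: "(\<Sum>c\<in>C. ?h c * (?h c - 1) * (?h c - 2)) = M * ((2/3)^3 * (n * (n-1) * (n-2)))"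
    using mom[of 3] by (simp add: prod.atLeast0_lessThan_Suc eval_nat_numeral)
  have m4: "(\<Sum>c\<in>C. ?h c * (?h c - 1) * (?h c - 2) * (?h c - 3))
      = M * ((2/3)^4 * (n * (n-1) * (n-2) * (n-3)))"
    using mom[of 4] by (simp add: prod.atLeast0_lessThan_Suc eval_nat_numeral)
  have m5: "(\<Sum>c\<in>C. ?h c * (?h c - 1) * (?h c - 2) * (?h c - 3) * (?h c - 4))
      = M * ((2/3)^5 * (n * (n-1) * (n-2) * (n-3) * (n-4)))"
    using mom[of 5] by (simp add: prod.atLeast0_lessThan_Suc eval_nat_numeral)
  have m6: "(\<Sum>c\<in>C. ?h c * (?h c - 1) * (?h c - 2) * (?h c - 3) * (?h c - 4) * (?h c - 5))
      = M * ((2/3)^6 * (n * (n-1) * (n-2) * (n-3) * (n-4) * (n-5)))"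
    using mom[of 6] by (simp add: prod.atLeast0_lessThan_Suc eval_nat_numeral)
  \<comment> \<open>The factor \<open>g\<close> kills the zero codeword, \<open>f\<close> all
    others.\<close>
  have vanish: "(\<Sum>c\<in>C. g (?h c) * f (?h c)) = 0" if "g 0 = 0" for g
  proof (rule sum.neutral, rule ballI)
    fix c assume "c \<in> C"
    then show "g (?h c) * f (?h c) = 0"
      using f[of c] that hamming_weight_eq_0_iff[of c] by (cases "c = 0") auto
  qed
  \<comment> \<open>For each multiplier the product with \<open>f\<close> is written in falling
    factorials, for the higher ones by splittings such as \<open>x - 1 = (x - 4) + 3\<close>, so
    that the moments can be inserted.\<close>
  have "0 = (\<Sum>c\<in>C. ?h c * f (?h c))" using vanish[of "\<lambda>x. x"] by simp
  also have "\<dots> = (\<Sum>c\<in>C. ?h c * (?h c - 1) * (?h c - 2) * (?h c - 3)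
      + \<alpha> * (?h c * (?h c - 1) * (?h c - 2)) + \<beta> * (?h c * (?h c - 1)) + \<gamma> * ?h c)"
    by (rule sum.cong) (auto simp: f_eq algebra_simps)
  also have "\<dots> = M * ((2/3)^4 * (n*(n-1)*(n-2)*(n-3)) + \<alpha> * ((2/3)^3 * (n*(n-1)*(n-2)))
      + \<beta> * ((2/3)^2 * (n*(n-1))) + \<gamma> * ((2/3) * n))"
    unfolding sum.distrib sum_distrib_left[symmetric] m1 m2 m3 m4 by (simp add: distrib_left mult.left_commute)
  finally have E1: "(2/3)^4 * (n*(n-1)*(n-2)*(n-3)) + \<alpha> * ((2/3)^3 * (n*(n-1)*(n-2)))
      + \<beta> * ((2/3)^2 * (n*(n-1))) + \<gamma> * ((2/3) * n) = 0"
    using M0 by simp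
  have "0 = (\<Sum>c\<in>C. (?h c * (?h c - 1)) * f (?h c))"
    using vanish[of "\<lambda>x. x * (x - 1)"] by simp
  also have "\<dots> = (\<Sum>c\<in>C. ?h c * (?h c - 1) * (?h c - 2) * (?h c - 3) * (?h c - 4)
      + (3 + \<alpha>) * (?h c * (?h c - 1) * (?h c - 2) * (?h c - 3))
      + (2 * \<alpha> + \<beta>) * (?h c * (?h c - 1) * (?h c - 2)) + (\<beta> + \<gamma>) * (?h c * (?h c - 1)))"
    by (rule sum.cong) (auto simp: f_eq algebra_simps)
  also have "\<dots> = M * ((2/3)^5 * (n*(n-1)*(n-2)*(n-3)*(n-4))
      + (3 + \<alpha>) * ((2/3)^4 * (n*(n-1)*(n-2)*(n-3)))
      + (2 * \<alpha> + \<beta>) * ((2/3)^3 * (n*(n-1)*(n-2))) + (\<beta> + \<gamma>) * ((2/3)^2 * (n*(n-1))))"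
    unfolding sum.distrib sum_distrib_left[symmetric] m2 m3 m4 m5 by (simp add: distrib_left mult.left_commute)
  finally have E2: "(2/3)^5 * (n*(n-1)*(n-2)*(n-3)*(n-4))
      + (3 + \<alpha>) * ((2/3)^4 * (n*(n-1)*(n-2)*(n-3)))
      + (2 * \<alpha> + \<beta>) * ((2/3)^3 * (n*(n-1)*(n-2))) + (\<beta> + \<gamma>) * ((2/3)^2 * (n*(n-1))) = 0"
    using M0 by simp
  have "0 = (\<Sum>c\<in>C. (?h c * (?h c - 1) * (?h c - 2)) * f (?h c))"
    using vanish[of "\<lambda>x. x * (x - 1) * (x - 2)"] by simp
  also have "\<dots> = (\<Sum>c\<in>C. ?h c * (?h c - 1) * (?h c - 2) * (?h c - 3) * (?h c - 4) * (?h c - 5)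
      + (6 + \<alpha>) * (?h c * (?h c - 1) * (?h c - 2) * (?h c - 3) * (?h c - 4))
      + (6 + 4 * \<alpha> + \<beta>) * (?h c * (?h c - 1) * (?h c - 2) * (?h c - 3))
      + (2 * \<alpha> + 2 * \<beta> + \<gamma>) * (?h c * (?h c - 1) * (?h c - 2)))"
    by (rule sum.cong) (auto simp: f_eq algebra_simps)
  also have "\<dots> = M * ((2/3)^6 * (n*(n-1)*(n-2)*(n-3)*(n-4)*(n-5))
      + (6 + \<alpha>) * ((2/3)^5 * (n*(n-1)*(n-2)*(n-3)*(n-4)))
      + (6 + 4 * \<alpha> + \<beta>) * ((2/3)^4 * (n*(n-1)*(n-2)*(n-3)))
      + (2 * \<alpha> + 2 * \<beta> + \<gamma>) * ((2/3)^3 * (n*(n-1)*(n-2))))"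
    unfolding sum.distrib sum_distrib_left[symmetric] m3 m4 m5 m6 by (simp add: distrib_left mult.left_commute)
  finally have E3: "(2/3)^6 * (n*(n-1)*(n-2)*(n-3)*(n-4)*(n-5))
      + (6 + \<alpha>) * ((2/3)^5 * (n*(n-1)*(n-2)*(n-3)*(n-4)))
      + (6 + 4 * \<alpha> + \<beta>) * ((2/3)^4 * (n*(n-1)*(n-2)*(n-3)))
      + (2 * \<alpha> + 2 * \<beta> + \<gamma>) * ((2/3)^3 * (n*(n-1)*(n-2))) = 0"
    using M0 by simp
  note sol = lloyd_elementary_symmetric[OF n7 E1 E2 E3]
  have s1: "s1 = 2 * n" using sol(1) by (simp add: \<alpha>_def)
  have s2: "s2 = (4 * n^2 - 2 * n + 3) / 3"
    using sol(2) by (simp add: \<beta>_def s1 field_simps power2_eq_square)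
  have s3: "s3 = 1 - s1 + s2 + (8/27) * (n-1) * (n-2) * (n-3)"
    using sol(3) by (simp add: \<gamma>_def)
  \<comment> \<open>Only the zero codeword contributes to the sum of \<open>f\<close> over
    \<open>C\<close>; evaluating that sum by moments relates \<open>s3\<close> to
    \<open>M\<close>.\<close>
  have "- s3 = f 0" by (simp add: f_def s3_def)
  also have "\<dots> = (\<Sum>c\<in>C. if c = 0 then f 0 else 0)"
    using finC \<open>0 \<in> C\<close> by (simp add: sum.delta)
  also have "\<dots> = (\<Sum>c\<in>C. f (?h c))"
    by (rule sum.cong) (use f hamming_weight_eq_0_iff[of "0 :: 'a ^ 'n"] in auto)
  also have "\<dots> = (\<Sum>c\<in>C. ?h c * (?h c - 1) * (?h c - 2) + (3 - s1) * (?h c * (?h c - 1))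
      + (1 - s1 + s2) * ?h c - s3)"
    by (rule sum.cong) (auto simp: f_def s1_def s2_def s3_def algebra_simps)
  also have "\<dots> = M * ((2/3)^3 * (n*(n-1)*(n-2)) + (3 - s1) * ((2/3)^2 * (n*(n-1)))
      + (1 - s1 + s2) * ((2/3) * n) - s3)"
    unfolding sum.distrib sum_subtractf sum_distrib_left[symmetric] m1 m2 m3
    by (simp add: M_def algebra_simps)
  also have "(2/3)^3 * (n*(n-1)*(n-2)) + (3 - s1) * ((2/3)^2 * (n*(n-1)))
      + (1 - s1 + s2) * ((2/3) * n) - s3 = - (2/9)"
    unfolding s3 s2 s1 by (simp add: field_simps power_numeral_reduce)
  finally have "9 * s3 = 2 * M" by simp
  moreover obtain k where k: "card C = 3 ^ k" using card_subspace_power[OF fin C] q by auto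
  ultimately have "real (9 * (u * v * w)) = real (2 * 3 ^ k)" by (simp add: s3_def M_def)
  then have prod: "9 * (u * v * w) = 2 * 3 ^ k" by (simp only: of_nat_eq_iff)
  \<comment> \<open>Two distinct odd weights would both be powers of 3, hence differ by a factor of
    at least 3. The symmetric form covers every choice of the pair.\<close>
  have no_pair: False if xyz: "{x, y, z} = {u, v, w}" "x \<noteq> y" "odd x" "odd y"
    "real x + real y + real z = s1"
    "real x * real y + real y * real z + real x * real z = s2" for x y z
  proof -
    have "x \<in> {u, v, w}" "y \<in> {u, v, w}" using xyz(1) by blast+
    then have "x dvd 2 * 3 ^ k" "y dvd 2 * 3 ^ k" unfolding prod[symmetric] by auto
    then obtain a b where ab: "x = 3 ^ a" "y = 3 ^ b"
      using odd_dvd_two_times_power_three xyz(3,4) by metis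
    have ratio: "3 * 3 ^ i \<le> (3 ^ j :: real)" if "i < j" for i j :: nat
      using power_increasing[of "Suc i" j "3 :: real"] that by simp
    consider "a < b" | "b < a" using xyz(2) ab by fastforce
    then show False
    proof cases
      case 1
      show False
        by (rule no_lloyd_roots_of_ratio_three[OF n7, of x y z])
          (use ratio[OF 1] xyz(5,6) s1 s2 ab in \<open>auto simp: algebra_simps\<close>)
    next
      case 2
      show False
        by (rule no_lloyd_roots_of_ratio_three[OF n7, of y x z])
          (use ratio[OF 2] xyz(5,6) s1 s2 ab in \<open>auto simp: algebra_simps\<close>)
    qed
  qed
  \<comment> \<open>The product of the weights is even only once, so at most one weight is even and
    two are odd.\<close>
  have not4: "\<not> 4 dvd u * v * w"
  proof
    assume "4 dvd u * v * w"
    then have "4 dvd 2 * (3 ^ k :: nat)" unfolding prod[symmetric] by (rule dvd_mult)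
    then obtain m where "2 * (3 ^ k :: nat) = 4 * m" by (rule dvdE)
    then have "(3 ^ k :: nat) = 2 * m" by simp
    then have "even (3 ^ k :: nat)" by (rule dvdI)
    then show False by simp
  qed
  have "odd x \<or> odd y" if "x * y dvd u * v * w" for x y
    using not4 that mult_dvd_mono[of 2 x 2 y] dvd_trans by auto
  from this[of u v] this[of v w] this[of u w]
  consider "odd u \<and> odd v" | "odd v \<and> odd w" | "odd u \<and> odd w"
    by (auto simp: mult_ac)
  then show False
  proof cases
    case 1
    then show False using no_pair[of u v w] dist by (simp add: s1_def s2_def)
  next
    case 2
    then show False using no_pair[of v w u] dist by (simp add: s1_def s2_def insert_commute mult_ac add_ac)
  next
    case 3
    then show False using no_pair[of u w v] dist by (simp add: s1_def s2_def insert_commute mult_ac add_ac)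
  qed
qed

section \<open>Codes whose nonzero words all have fewer than \<open>d'\<close> zeros\<close>

text \<open>Remove one coordinate from the support of a minimum weight dual word. A codeword
  vanishing on the rest vanishes at the removed place by orthogonality, so it has \<open>d'\<close>
  zeros and is 0. The orthogonal array property on these \<open>d' - 1\<close> coordinates then
  counts \<open>C\<close>.\<close>

lemma card_eq_of_no_small_weight:
  fixes C :: "(('a::field) ^ 'n::finite) set"
  assumes fin: "finite (UNIV :: 'a set)" and C: "vec.subspace C"
    and d': "is_min_weight (dual_code C) d'" "d' > 0"
    and large: "\<And>c. c \<in> C \<Longrightarrow> c \<noteq> 0 \<Longrightarrow> card {i. c $ i = 0} < d'"
  shows "card C = CARD('a) ^ (d' - 1)"
proof -
  obtain x where x: "x \<in> dual_code C" "hamming_weight x = d'"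
    using d' by (auto simp: is_min_weight_def)
  define S where "S = {i. x $ i \<noteq> 0}"
  have card_S: "card S = d'" using x by (simp add: S_def hamming_weight_def)
  then obtain i where i: "i \<in> S" using d'(2) by fastforce
  have card_Si: "card (S - {i}) = d' - 1" using card_S i by simp
  have "c = 0" if c: "c \<in> C" "\<forall>j\<in>S - {i}. c $ j = 0" for c
  proof (rule ccontr)
    assume "c \<noteq> 0"
    have "x $ i * c $ i = (\<Sum>j\<in>UNIV. if j = i then x $ j * c $ j else 0)" by simp
    also have "\<dots> = (\<Sum>j\<in>UNIV. x $ j * c $ j)"
      by (rule sum.cong) (use c in \<open>auto simp: S_def\<close>)
    also have "\<dots> = 0" using x c by (simp add: dual_code_def)
    finally have "S \<subseteq> {j. c $ j = 0}" using c i by (auto simp: S_def)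
    then have "card S \<le> card {j. c $ j = 0}" by (intro card_mono) auto
    then show False using large[OF c(1) \<open>c \<noteq> 0\<close>] card_S by simp
  qed
  then have "{c \<in> C. \<forall>j\<in>S - {i}. c $ j \<in> {0}} = {0}" using vec.subspace_0[OF C] by auto
  then show ?thesis
    using card_orthogonal_array[OF fin C d'(1), of "S - {i}" "{0}"] card_Si d'(2) by simp
qed

text \<open>With at most five zeros per nonzero word, the moments of order 0 to 5 form a triangular
  system for the numbers \<open>N i\<close> of words with \<open>i\<close> zeros.\<close>

lemma no_three_weights_all_large:
  fixes C :: "(('a::field) ^ 'n::finite) set"
  assumes q: "CARD('a) = 3" and C: "vec.subspace C"
    and d': "is_min_weight (dual_code C) 6"
    and large: "\<And>c. c \<in> C \<Longrightarrow> c \<noteq> 0 \<Longrightarrow> card {i. c $ i = 0} < 6"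
  shows "card {u. weight_class C u \<noteq> {} \<and> 0 < u} \<noteq> 3"
proof
  assume three: "card {u. weight_class C u \<noteq> {} \<and> 0 < u} = 3"
  have fin: "finite (UNIV :: 'a set)" using q card_ge_0_finite by force
  have finC: "finite C" by (rule finite_subset[OF subset_UNIV finite_vec_UNIV[OF fin]])
  have cardC: "card C = 243"
    using card_eq_of_no_small_weight[OF fin C d' _ large] q by simp
  have "0 \<in> C" by (rule vec.subspace_0[OF C])
  define n where "n = CARD('n)"
  have n6: "n \<ge> 6"
  proof -
    obtain x where "hamming_weight (x :: 'a ^ 'n) = 6" using d' by (auto simp: is_min_weight_def)
    then show ?thesis using hamming_weight_le[of x] by (simp add: n_def)
  qed
  define N where "N i = card {c \<in> C - {0}. card {i. c $ i = 0} = i}" for i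
  \<comment> \<open>The zero codeword, with \<open>n\<close> zeros, is split off as the term
    \<open>n choose j\<close>, because \<open>large\<close> does not bound it.\<close>
  have mom: "3 ^ j * ((n choose j) + (\<Sum>i<6. N i * (i choose j))) = 243 * (n choose j)" if "j < 6" for j
  proof -
    have "(\<Sum>c\<in>C - {0}. card {i. c $ i = 0} choose j)
        = (\<Sum>i<6. \<Sum>c\<in>{c \<in> C - {0}. card {i. c $ i = 0} = i}. card {i. c $ i = 0} choose j)"
      by (rule sum.group[symmetric]) (use finC large in auto)
    also have "\<dots> = (\<Sum>i<6. N i * (i choose j))" by (simp add: N_def)
    finally have "(\<Sum>c\<in>C. card {i. c $ i = 0} choose j) = (n choose j) + (\<Sum>i<6. N i * (i choose j))"
      using sum.remove[OF finC \<open>0 \<in> C\<close>, of "\<lambda>c. card {i. c $ i = 0} choose j"] by (simp add: n_def)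
    then show ?thesis
      using sum_binomial_moments[OF fin C d' that, of "{0}"] by (simp add: q cardC n_def)
  qed
  have ex: "n - i \<in> {u. weight_class C u \<noteq> {} \<and> 0 < u}" if Ni: "N i > 0" for i
  proof -
    obtain c where c: "c \<in> C" "c \<noteq> 0" "card {i. c $ i = 0} = i"
      using Ni by (auto simp: N_def card_gt_0_iff)
    then have "hamming_weight c = n - i"
      using card_zeros_eq[of c] hamming_weight_le[of c] by (simp add: n_def)
    moreover have "hamming_weight c > 0" using c(2) hamming_weight_eq_0_iff[of c] by simp
    ultimately show ?thesis using c(1) by (auto simp: weight_class_def)
  qed
  have "(\<Sum>i<6. N i * (i choose 5)) = N 5"
    by (simp add: lessThan_Suc eval_nat_numeral)
  \<comment> \<open>As \<open>3 ^ 5 = 243\<close>, the zero codeword alone exhausts the fifth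
    moment.\<close>
  with mom[of 5] have N5: "N 5 = 0" by simp
  have "(\<Sum>i<6. N i * (i choose 4)) = N 4 + 5 * N 5"
    by (simp add: lessThan_Suc eval_nat_numeral)
  with mom[of 4] N5 have N4: "N 4 = 2 * (n choose 4)" by simp
  have "(\<Sum>i<6. N i * (i choose 3)) = N 3 + 4 * N 4 + 10 * N 5"
    by (simp add: lessThan_Suc eval_nat_numeral)
  with mom[of 3] N5 have N3: "N 3 + 4 * N 4 = 8 * (n choose 3)" by simp
  have "(\<Sum>i<6. N i * (i choose 2)) = N 2 + 3 * N 3 + 6 * N 4 + 10 * N 5"
    by (simp add: lessThan_Suc eval_nat_numeral)
  with mom[of 2] N5 have N2: "N 2 + 3 * N 3 + 6 * N 4 = 26 * (n choose 2)" by simp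
  have "(\<Sum>i<6. N i * (i choose 1)) = N 1 + 2 * N 2 + 3 * N 3 + 4 * N 4 + 5 * N 5"
    by (simp add: lessThan_Suc eval_nat_numeral)
  with mom[of 1] N5 have N1: "N 1 + 2 * N 2 + 3 * N 3 + 4 * N 4 = 80 * n" by simp
  have "(\<Sum>i<6. N i * (i choose 0)) = N 0 + N 1 + N 2 + N 3 + N 4 + N 5"
    by (simp add: lessThan_Suc eval_nat_numeral)
  with mom[of 0] N5 have N0: "N 0 + N 1 + N 2 + N 3 + N 4 = 242" by simp
  \<comment> \<open>For larger \<open>n\<close> the value
    \<open>8 * ((n choose 3) - (n choose 4))\<close> of \<open>N 3\<close> would be
    negative.\<close>
  have "n \<le> 7"
  proof (rule ccontr)
    assume "\<not> n \<le> 7"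
    then have "5 * (n choose 3) \<le> (n - 3) * (n choose 3)" by (intro mult_right_mono) auto
    also have "\<dots> = 4 * (n choose 4)"
      using binomial_absorb_comp[of n 3] binomial_absorption[of 3 n] by simp
    finally have "5 * (n choose 3) \<le> 4 * (n choose 4)" .
    moreover have "n choose 3 > 0" using n6 by simp
    ultimately show False using N3 N4 by simp
  qed
  with n6 have n67: "n = 6 \<or> n = 7" by auto
  then have "n = 6 \<and> n choose 2 = 15 \<and> n choose 3 = 20 \<and> n choose 4 = 15 \<or>
      n = 7 \<and> n choose 2 = 21 \<and> n choose 3 = 35 \<and> n choose 4 = 35"
    by (elim disjE) (simp_all add: eval_nat_numeral)
  \<comment> \<open>The values of \<open>N 4\<close> down to \<open>N 0\<close> are 30, 40, 90, 60,
    22 for \<open>n = 6\<close> and 70, 0, 126, 28, 18 for \<open>n = 7\<close>; \<open>N 3\<close>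
    is left out because of the 0.\<close>
  then have Npos: "N 4 > 0" "N 2 > 0" "N 1 > 0" "N 0 > 0"
    using N4 N3 N2 N1 N0 by linarith+
  have "{n - 4, n - 2, n - 1, n - 0} \<subseteq> {u. weight_class C u \<noteq> {} \<and> 0 < u}"
    using ex Npos by blast
  then have "card {n - 4, n - 2, n - 1, n - 0} \<le> 3"
    unfolding three[symmetric] by (rule card_mono[rotated]) (use three card_ge_0_finite in force)
  moreover have "card {n - 4, n - 2, n - 1, n - 0} = 4" using n67 by auto
  ultimately show False by simp
qed

section \<open>Both bounds from the AM-condition\<close>

theorem theorem1p2:
  fixes C :: "(('a::field) ^ 'n::finite) set"
    and n k d d' t :: nat
  assumes "CARD('a) = 3"
    and "is_linear_code n k d C"
    and "three_weight_code C"
    and "is_min_weight (dual_code C) d'"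
    and "AM_condition C d' t"
  shows "d' \<le> 6 \<and> t \<le> 5"
proof -
  have C: "vec.subspace C" using assms(2) by (simp add: is_linear_code_def)
  have three: "card {u. weight_class C u \<noteq> {} \<and> 0 < u} = 3"
    using assms(3) by (simp add: three_weight_code_def)
  have d'6: "d' \<le> 6"
    by (rule three_weights_dual_distance_le_6[OF assms(1) C assms(4) three])
  let ?U = "{u. weight_class C u \<noteq> {} \<and> 0 < u \<and> int u \<le> int CARD('n) - int t}"
  have AM: "int d' - int t = int (card ?U)" using assms(5) by (simp add: AM_condition_def)
  have False if "t > 5"
  proof -
    \<comment> \<open>A cardinality is nonnegative, so \<open>t \<le> d' \<le> 6\<close>.\<close>
    have t6: "t = 6" "d' = 6" "card ?U = 0" using AM d'6 that by linarith+
    \<comment> \<open>Needed because \<open>card\<close> is also 0 on infinite sets.\<close>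
    have "finite ?U"
      by (rule finite_subset[of _ "{u. weight_class C u \<noteq> {} \<and> 0 < u}"])
        (use three card_ge_0_finite in force)+
    with t6 have U: "?U = {}" by simp
    \<comment> \<open>Emptiness of \<open>?U\<close> says that every nonzero codeword has weight
      above \<open>CARD('n) - 6\<close>.\<close>
    have "card {i. c $ i = 0} < 6" if c: "c \<in> C" "c \<noteq> 0" for c
    proof -
      have "0 < hamming_weight c" using c(2) hamming_weight_eq_0_iff[of c] by simp
      moreover have "hamming_weight c \<notin> ?U" using U by simp
      ultimately have "\<not> int (hamming_weight c) \<le> int CARD('n) - int t"
        using c(1) by (auto simp: weight_class_def)
      then show ?thesis using card_zeros_eq[of c] hamming_weight_le[of c] t6 by linarith
    qed
    then show False using no_three_weights_all_large[OF assms(1) C] assms(4) three t6 by blast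
  qed
  then show ?thesis using d'6 by force
qed

end
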